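(* Let $f: X \to Y$ be a function with $\mathrm{Eff}(X,f)\neq\emptyset$. Then, for every $\bar x \in \mathrm{Eff}(X, f)$, there exists a sequence of functions $f_n: X \to Y$ such that $f_n \to f$ uniformly on bounded subsets of $X$, $\bar x \in \mathrm{Eff}(X, f_n)$ for every $n$, and the problem $(X, f_n)$ is DH-well-posed at $\bar x$ for every $n$. Further, if $f$ is continuous, then $\bar x \in \mathrm{StEff}(X, f_n)$ for every $n$.
   Context: $X$ and $Y$ are (real) Banach spaces, and $C \subseteq Y$ is a closed, convex, pointed cone with nonempty interior. $B$ denotes the closed unit ball of $Y$. For $f:X\to Y$, the problem $(X,f)$ is the vector optimization problem $\min f(x)$, $x\in X$, with respect to the order $y_1\le_C y_2 \iff y_2-y_1\in C$. Efficient solutions: $\mathrm{Eff}(X,f)$ is the set of all $\bar x\in X$ such that $(f(X)-f(\bar x))\cap(-C)=\{0\}$. Strictly efficient solutions: $\mathrm{StEff}(X,f)$ is the set of all $\bar x\in X$ such that for every $\varepsilon>0$ there exists $\delta>0$ with $(f(X)-f(\bar x))\cap(\delta B-C)\subseteq \varepsilon B$. DH-well-posedness: the problem $(X,f)$ is DH-well-posed at $\bar x\in \mathrm{Eff}(X,f)$ if $\inf_{\alpha>0}\mathrm{diam}\, L_f^C(f(\bar x)+\alpha c)=0$ for every $c\in C$, where $L_f^C(y)=\{x\in X: f(x)\in y-C\}$ and $\mathrm{diam}\,A=\sup\{\|x-y\|: x,y\in A\}$.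
   Formalization: The Banach space Y is assumed to be nonzero; for Y = {0}, C = {0} and X nonzero, every function is constant, every sublevel set is all of X with infinite diameter, and no problem (X, f_n) is DH-well-posed, so the claim fails there. *)

theory Defs
  imports "HOL-Analysis.Analysis"
begin

definition pointed :: "'b::real_normed_vector set \<Rightarrow> bool" where
  "pointed C \<longleftrightarrow> C \<inter> uminus ` C = {0}"

definition Eff :: "'b::real_normed_vector set \<Rightarrow> ('a \<Rightarrow> 'b) \<Rightarrow> 'a set" where
  "Eff C f = {x. {f z - f x | z. True} \<inter> uminus ` C = {0}}"

definition StEff :: "'b::real_normed_vector set \<Rightarrow> ('a \<Rightarrow> 'b) \<Rightarrow> 'a set" where
  "StEff C f = {x. \<forall>\<epsilon>>0. \<exists>\<delta>>0.
     {f z - f x | z. True} \<inter> {\<delta> *\<^sub>R b - c | b c. b \<in> cball 0 1 \<and> c \<in> C}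
       \<subseteq> (\<lambda>b. \<epsilon> *\<^sub>R b) ` cball 0 1}"

definition sublevel :: "'b::real_normed_vector set \<Rightarrow> ('a \<Rightarrow> 'b) \<Rightarrow> 'b \<Rightarrow> 'a set" where
  "sublevel C f y = {x. f x \<in> {y - c | c. c \<in> C}}"

(* The diameter is taken in [0, \<infinity>]: the library's real-valued diameter is
   unspecified for unbounded sets, and sublevel sets may be unbounded. *)
definition ediam :: "'a::real_normed_vector set \<Rightarrow> ennreal" where
  "ediam A = (SUP p\<in>A \<times> A. ennreal (norm (fst p - snd p)))"

definition DH_well_posed_at ::
  "'b::real_normed_vector set \<Rightarrow> ('a::real_normed_vector \<Rightarrow> 'b) \<Rightarrow> 'a \<Rightarrow> bool" where
  "DH_well_posed_at C f x \<longleftrightarrow> x \<in> Eff C f \<and>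
     (\<forall>c\<in>C. (INF \<alpha>\<in>{0<..}. ediam (sublevel C f (f x + \<alpha> *\<^sub>R c))) = 0)"

end

theory Submission
  imports Defs
begin

text \<open>
  The approximants penalise the distance to the given efficient point in an interior direction of
  the cone: with \<open>e \<in> interior C\<close> and \<open>s = 1 / (n + 1)\<close> they are
  \<open>z \<mapsto> f z + s * norm (z - x) * e\<close>.  The penalty vanishes at \<open>x\<close> and is at most a multiple of \<open>s\<close>
  on any bounded set, which gives the convergence.

  The rest follows from one estimate (\<open>penalised_bound\<close>): if the penalised value at \<open>z\<close> exceeds
  \<open>f x\<close> by at most \<open>t * e\<close> in the cone order, then \<open>s * norm (z - x) \<le> t\<close>.  Otherwise \<open>f z\<close>
  would lie below \<open>f x\<close> by a positive multiple of \<open>e\<close>, against the efficiency of \<open>x\<close>.  Because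
  \<open>e\<close> is an order unit (\<open>interior_order_unit\<close>), every perturbation \<open>y\<close> is dominated by
  \<open>K * norm y * e\<close>, so the estimate confines each set of almost minimal points to a small ball
  around \<open>x\<close>.  The case \<open>t = 0\<close> is efficiency; the perturbations \<open>\<alpha> * c\<close> give sublevel sets of
  diameter \<open>O(\<alpha>)\<close>, which is DH-well-posedness; the perturbations in \<open>\<delta> * B\<close> put \<open>z\<close> close to \<open>x\<close>,
  and continuity at \<open>x\<close> turns this into closeness of values, which is strict efficiency.
\<close>

definition penalised :: "('a::real_normed_vector \<Rightarrow> 'b::real_normed_vector) \<Rightarrow> 'a \<Rightarrow> 'b \<Rightarrow> real \<Rightarrow> 'a \<Rightarrow> 'b"
  where "penalised f x e s z = f z + (s * norm (z - x)) *\<^sub>R e"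

lemma penalised_base [simp]: "penalised f x e s x = f x"
  by (simp add: penalised_def)

lemma convex_cone_add:
  assumes "convex C" "cone C" "a \<in> C" "b \<in> C"
  shows "a + b \<in> C"
  using convex_cone[of C] assms by blast

text \<open>A ball around \<open>e\<close> inside the cone contains \<open>e - y\<close> for all short \<open>y\<close>; scaling reaches every
  \<open>y\<close>, with a constant that depends on the radius only.\<close>

lemma interior_order_unit:
  fixes C :: "'b::real_normed_vector set"
  assumes "cone C" "e \<in> interior C"
  obtains K where "K > 0" "\<And>y. (K * norm y) *\<^sub>R e - y \<in> C"
proof -
  obtain r where r: "r > 0" "cball e r \<subseteq> C"
    using assms(2) by (auto simp: mem_interior_cball)
  have "(1 / r * norm y) *\<^sub>R e - y \<in> C" for y
  proof (cases "y = 0")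
    case True
    have "e \<in> C" using r by auto
    then have "0 *\<^sub>R e \<in> C" using assms(1) by (meson mem_cone order_refl)
    then show ?thesis using True by simp
  next
    case False
    have "e - (r / norm y) *\<^sub>R y \<in> cball e r"
      using False r(1) by (simp add: dist_norm)
    then have "(norm y / r) *\<^sub>R (e - (r / norm y) *\<^sub>R y) \<in> C"
      using r assms(1) by (intro mem_cone) auto
    then show ?thesis using False r(1) by (simp add: algebra_simps)
  qed
  then show ?thesis using that[of "1 / r"] r(1) by simp
qed

text \<open>If \<open>0\<close> were an interior point, the cone would be the whole nontrivial space, hence not
  pointed.\<close>

lemma interior_pointed_cone_nonzero:
  fixes C :: "'b::real_normed_vector set"
  assumes "\<exists>y::'b. y \<noteq> 0" "cone C" "pointed C" "e \<in> interior C"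
  shows "e \<noteq> 0"
proof
  assume "e = 0"
  obtain K where K: "\<And>y. (K * norm y) *\<^sub>R e - y \<in> C"
    using interior_order_unit[OF assms(2,4)] by blast
  obtain y :: 'b where "y \<noteq> 0" using assms(1) by blast
  have "- y \<in> C" "y \<in> C"
    using K[of y] K[of "- y"] \<open>e = 0\<close> by simp_all
  then have "y \<in> C \<inter> uminus ` C"
    by (metis IntI image_eqI minus_minus)
  then show False
    using \<open>y \<noteq> 0\<close> unfolding assms(3)[unfolded pointed_def] by simp
qed

lemma Eff_iff:
  assumes "(0::'b::real_normed_vector) \<in> C"
  shows "x \<in> Eff C f \<longleftrightarrow> (\<forall>z. f x - f z \<in> C \<longrightarrow> f z = f x)"
proof -
  have neg: "v \<in> uminus ` C \<longleftrightarrow> - v \<in> C" for v :: 'b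
    by (metis image_iff minus_minus)
  have "f x - f x \<in> uminus ` C" using assms by (simp add: neg)
  then have "0 \<in> {f z - f x |z. True} \<inter> uminus ` C"
    by (metis (mono_tags, lifting) IntI diff_self mem_Collect_eq)
  then have "x \<in> Eff C f \<longleftrightarrow> (\<forall>z. f z - f x \<in> uminus ` C \<longrightarrow> f z - f x = 0)"
    unfolding Eff_def by blast
  then show ?thesis by (simp add: neg)
qed

text \<open>The efficiency of \<open>x\<close> forbids any gain of \<open>f\<close> in the direction \<open>e\<close>, so the allowance
  \<open>t * e\<close> must pay for the whole penalty.\<close>

lemma penalised_bound:
  fixes C :: "'b::real_normed_vector set"
  assumes "convex C" "cone C" "pointed C" "e \<in> C" "e \<noteq> 0" "x \<in> Eff C f"
    and le: "t *\<^sub>R e - (penalised f x e s z - f x) \<in> C"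
  shows "s * norm (z - x) \<le> t"
proof (rule ccontr)
  define k where "k = s * norm (z - x) - t"
  assume "\<not> s * norm (z - x) \<le> t"
  then have k: "k > 0" by (simp add: k_def)
  have below: "f x - f z - k *\<^sub>R e \<in> C"
    using le by (simp add: penalised_def k_def algebra_simps)
  have "k *\<^sub>R e \<in> C" using assms k by (simp add: mem_cone)
  then have "f x - f z \<in> C"
    using convex_cone_add[OF assms(1,2) below, of "k *\<^sub>R e"] by simp
  then have "f z = f x"
    using assms(6) Eff_iff[of C x f] assms(3) by (auto simp: pointed_def)
  then have "- (k *\<^sub>R e) \<in> C" using below by simp
  then have "k *\<^sub>R e \<in> C \<inter> uminus ` C"
    using \<open>k *\<^sub>R e \<in> C\<close> by (metis IntI image_eqI minus_minus)
  then have "k *\<^sub>R e = 0" using assms(3) unfolding pointed_def by blast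
  then show False using assms(5) k by simp
qed

text \<open>The form in which the estimate meets almost minimal points: the excess over \<open>f x\<close> is
  bounded by an arbitrary vector \<open>y\<close>, which the order unit dominates.\<close>

lemma penalised_bound_perturbed:
  fixes C :: "'b::real_normed_vector set"
  assumes "convex C" "cone C" "pointed C" "e \<in> C" "e \<noteq> 0" "x \<in> Eff C f"
    and K: "(K * norm y) *\<^sub>R e - y \<in> C"
    and le: "y - (penalised f x e s z - f x) \<in> C"
  shows "s * norm (z - x) \<le> K * norm y"
proof (rule penalised_bound[OF assms(1-6)])
  show "(K * norm y) *\<^sub>R e - (penalised f x e s z - f x) \<in> C"
    using convex_cone_add[OF assms(1,2) K le] by (simp only: add_diff_eq diff_add_cancel)
qed

lemma penalised_Eff:
  fixes C :: "'b::real_normed_vector set"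
  assumes "convex C" "cone C" "pointed C" "e \<in> C" "e \<noteq> 0" "x \<in> Eff C f" "s > 0"
  shows "x \<in> Eff C (penalised f x e s)"
proof -
  have "z = x" if "f x - penalised f x e s z \<in> C" for z
    using penalised_bound[OF assms(1-6), of 0 s z] that \<open>s > 0\<close>
    by (simp add: mult_le_0_iff)
  moreover have "0 \<in> C" using assms(3) by (auto simp: pointed_def)
  ultimately show ?thesis
    unfolding Eff_iff[OF \<open>0 \<in> C\<close>] penalised_base using penalised_base by metis
qed

lemma ediam_le_if_subset_cball:
  assumes "A \<subseteq> cball x r"
  shows "ediam A \<le> ennreal (2 * r)"
  unfolding ediam_def
proof (rule SUP_least, rule ennreal_leI)
  fix p assume "p \<in> A \<times> A"
  then have "norm (fst p - x) \<le> r" "norm (snd p - x) \<le> r"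
    using assms by (auto simp: dist_norm norm_minus_commute)
  then show "norm (fst p - snd p) \<le> 2 * r"
    using norm_triangle_ineq4[of "fst p - x" "snd p - x"] by simp
qed

lemma penalised_DH_well_posed:
  fixes C :: "'b::real_normed_vector set"
  assumes "convex C" "cone C" "pointed C" "e \<in> interior C" "e \<noteq> 0" "x \<in> Eff C f" "s > 0"
  shows "DH_well_posed_at C (penalised f x e s) x"
  unfolding DH_well_posed_at_def
proof (intro conjI ballI)
  let ?g = "penalised f x e s"
  have eC: "e \<in> C" using assms(4) interior_subset by blast
  show "x \<in> Eff C ?g" by (rule penalised_Eff) (use assms eC in auto)
  fix c assume "c \<in> C"
  obtain K where K: "K > 0" "\<And>y. (K * norm y) *\<^sub>R e - y \<in> C"
    using interior_order_unit[OF assms(2,4)] by blast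
  let ?r = "\<lambda>\<alpha>. \<alpha> * (K * norm c / s)"
  have sub: "sublevel C ?g (?g x + \<alpha> *\<^sub>R c) \<subseteq> cball x (?r \<alpha>)" if "\<alpha> > 0" for \<alpha>
  proof
    fix z assume "z \<in> sublevel C ?g (?g x + \<alpha> *\<^sub>R c)"
    then obtain d where d: "d \<in> C" "?g z = f x + \<alpha> *\<^sub>R c - d"
      by (auto simp: sublevel_def)
    then have "\<alpha> *\<^sub>R c - (?g z - f x) \<in> C" by simp
    from penalised_bound_perturbed[OF assms(1-3) eC assms(5,6) K(2) this]
    show "z \<in> cball x (?r \<alpha>)"
      using \<open>s > 0\<close> that by (simp add: dist_norm norm_minus_commute field_simps)
  qed
  have "(INF \<alpha>\<in>{0<..}. ediam (sublevel C ?g (?g x + \<alpha> *\<^sub>R c))) \<le> 0"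
  proof (rule ennreal_le_epsilon)
    fix \<epsilon> :: real assume "\<epsilon> > 0"
    \<comment> \<open>Adding 1 to the denominator covers \<open>c = 0\<close>.\<close>
    define \<alpha> where "\<alpha> = \<epsilon> / (2 * (K * norm c / s) + 1)"
    have pos: "2 * (K * norm c / s) + 1 > 0"
      using K(1) \<open>s > 0\<close> by (intro add_nonneg_pos) auto
    have \<alpha>: "\<alpha> > 0" using pos \<open>\<epsilon> > 0\<close> by (simp add: \<alpha>_def)
    have "2 * ?r \<alpha> \<le> \<alpha> * (2 * (K * norm c / s) + 1)"
      using \<alpha> by (simp add: algebra_simps)
    also have "\<dots> = \<epsilon>" using pos by (simp add: \<alpha>_def)
    finally have "2 * ?r \<alpha> \<le> \<epsilon>" .
    have "(INF \<alpha>\<in>{0<..}. ediam (sublevel C ?g (?g x + \<alpha> *\<^sub>R c)))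
        \<le> ediam (sublevel C ?g (?g x + \<alpha> *\<^sub>R c))"
      using \<alpha> by (intro INF_lower) simp
    also have "\<dots> \<le> ennreal (2 * ?r \<alpha>)"
      using ediam_le_if_subset_cball[OF sub[OF \<alpha>]] .
    also have "\<dots> \<le> ennreal \<epsilon>" using \<open>2 * ?r \<alpha> \<le> \<epsilon>\<close> by (rule ennreal_leI)
    finally show "(INF \<alpha>\<in>{0<..}. ediam (sublevel C ?g (?g x + \<alpha> *\<^sub>R c))) \<le> 0 + ennreal \<epsilon>"
      by simp
  qed
  then show "(INF \<alpha>\<in>{0<..}. ediam (sublevel C ?g (?g x + \<alpha> *\<^sub>R c))) = 0" by simp
qed

lemma penalised_StEff:
  fixes C :: "'b::real_normed_vector set"
  assumes "convex C" "cone C" "pointed C" "e \<in> interior C" "e \<noteq> 0" "x \<in> Eff C f" "s > 0"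
    and "isCont f x"
  shows "x \<in> StEff C (penalised f x e s)"
  unfolding StEff_def
proof (intro CollectI allI impI)
  let ?g = "penalised f x e s"
  fix \<epsilon> :: real assume "\<epsilon> > 0"
  have eC: "e \<in> C" using assms(4) interior_subset by blast
  obtain K where K: "K > 0" "\<And>y. (K * norm y) *\<^sub>R e - y \<in> C"
    using interior_order_unit[OF assms(2,4)] by blast
  have "isCont ?g x"
    unfolding penalised_def by (intro continuous_intros assms(8))
  then obtain \<eta> where \<eta>: "\<eta> > 0" "\<And>z. dist z x < \<eta> \<Longrightarrow> dist (?g z) (?g x) < \<epsilon>"
    using \<open>\<epsilon> > 0\<close> unfolding continuous_at_eps_delta by blast
  \<comment> \<open>Then \<open>K * \<delta> / s < \<eta>\<close>, where \<open>K * \<delta> / s\<close> is the radius given by the bound.\<close>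
  define \<delta> where "\<delta> = s * \<eta> / (2 * K)"
  have \<delta>: "\<delta> > 0" using \<eta> K \<open>s > 0\<close> by (simp add: \<delta>_def)
  have "{?g z - ?g x | z. True} \<inter> {\<delta> *\<^sub>R b - c | b c. b \<in> cball 0 1 \<and> c \<in> C}
       \<subseteq> (\<lambda>b. \<epsilon> *\<^sub>R b) ` cball 0 1"
  proof
    fix v assume "v \<in> {?g z - ?g x | z. True} \<inter> {\<delta> *\<^sub>R b - c | b c. b \<in> cball 0 1 \<and> c \<in> C}"
    then obtain z b c where v: "v = ?g z - f x" "v = \<delta> *\<^sub>R b - c" "c \<in> C"
      and "b \<in> cball 0 1"
      unfolding penalised_base by blast
    then have b: "norm b \<le> 1" by simp
    have "\<delta> *\<^sub>R b - v \<in> C" using v(2,3) by simp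
    then have "\<delta> *\<^sub>R b - (?g z - f x) \<in> C" unfolding v(1) .
    from penalised_bound_perturbed[OF assms(1-3) eC assms(5,6) K(2) this]
    have "s * norm (z - x) \<le> K * (\<delta> * norm b)" using \<delta> by simp
    also have "\<dots> \<le> K * \<delta>" using b K(1) \<delta> by (simp add: mult_left_le)
    also have "\<dots> < s * \<eta>" using K(1) \<eta>(1) \<open>s > 0\<close> by (simp add: \<delta>_def)
    finally have "dist z x < \<eta>" using \<open>s > 0\<close> by (simp add: dist_norm)
    then have "norm v < \<epsilon>" using \<eta>(2)[of z] v(1) by (simp add: dist_norm)
    then have "(1 / \<epsilon>) *\<^sub>R v \<in> cball 0 1" using \<open>\<epsilon> > 0\<close> by simp
    moreover have "v = \<epsilon> *\<^sub>R ((1 / \<epsilon>) *\<^sub>R v)" using \<open>\<epsilon> > 0\<close> by simp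
    ultimately show "v \<in> (\<lambda>b. \<epsilon> *\<^sub>R b) ` cball 0 1" by (rule rev_image_eqI)
  qed
  then show "\<exists>\<delta>>0. {?g z - ?g x | z. True} \<inter> {\<delta> *\<^sub>R b - c | b c. b \<in> cball 0 1 \<and> c \<in> C}
       \<subseteq> (\<lambda>b. \<epsilon> *\<^sub>R b) ` cball 0 1"
    using \<delta> by blast
qed

lemma penalised_uniform_limit:
  fixes s :: "nat \<Rightarrow> real"
  assumes "bounded S" "s \<longlonglongrightarrow> 0"
  shows "uniform_limit S (\<lambda>n. penalised f x e (s n)) f sequentially"
proof (rule uniform_limitI)
  fix \<epsilon> :: real assume "\<epsilon> > 0"
  obtain R where R: "\<And>z. z \<in> S \<Longrightarrow> norm (z - x) \<le> R"
    using bounded_any_center[of S x] assms(1) by (auto simp: dist_norm norm_minus_commute)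
  have "(\<lambda>n. \<bar>s n\<bar> * (R * norm e)) \<longlonglongrightarrow> 0"
    using tendsto_mult_left_zero[OF tendsto_rabs_zero[OF assms(2)]] .
  then have "\<forall>\<^sub>F n in sequentially. \<bar>s n\<bar> * (R * norm e) < \<epsilon>"
    using \<open>\<epsilon> > 0\<close> by (rule order_tendstoD(2))
  then show "\<forall>\<^sub>F n in sequentially. \<forall>z\<in>S. dist (penalised f x e (s n) z) (f z) < \<epsilon>"
  proof eventually_elim
    case (elim n)
    show ?case
    proof
      fix z assume "z \<in> S"
      have "dist (penalised f x e (s n) z) (f z) = \<bar>s n\<bar> * (norm (z - x) * norm e)"
        by (simp add: penalised_def dist_norm abs_mult)
      also have "\<dots> \<le> \<bar>s n\<bar> * (R * norm e)"
        using R[OF \<open>z \<in> S\<close>] by (intro mult_left_mono mult_right_mono) auto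
      finally show "dist (penalised f x e (s n) z) (f z) < \<epsilon>" using elim by simp
    qed
  qed
qed

theorem theorem4p1:
  fixes f :: "'a::banach \<Rightarrow> 'b::banach" and C :: "'b set"
  assumes "\<exists>y::'b. y \<noteq> 0"
    and "closed C" and "convex C" and "cone C" and "pointed C" and "interior C \<noteq> {}"
    and "Eff C f \<noteq> {}"
  shows "\<forall>x\<in>Eff C f. \<exists>fn :: nat \<Rightarrow> 'a \<Rightarrow> 'b.
           (\<forall>S. bounded S \<longrightarrow> uniform_limit S fn f sequentially) \<and>
           (\<forall>n. x \<in> Eff C (fn n)) \<and>
           (\<forall>n. DH_well_posed_at C (fn n) x) \<and>
           (continuous_on UNIV f \<longrightarrow> (\<forall>n. x \<in> StEff C (fn n)))"
proof
  fix x assume x: "x \<in> Eff C f"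
  obtain e where e: "e \<in> interior C" using assms(6) by blast
  have e0: "e \<noteq> 0" by (rule interior_pointed_cone_nonzero[OF assms(1,4,5) e])
  define s where "s n = inverse (real (Suc n))" for n
  have s_pos: "s n > 0" for n by (simp add: s_def)
  have s_lim: "s \<longlonglongrightarrow> 0" unfolding s_def by (rule LIMSEQ_inverse_real_of_nat)
  have wp: "DH_well_posed_at C (penalised f x e (s n)) x" for n
    by (rule penalised_DH_well_posed[OF assms(3-5) e e0 x s_pos])
  have "x \<in> StEff C (penalised f x e (s n))" if "continuous_on UNIV f" for n
    using that by (intro penalised_StEff[OF assms(3-5) e e0 x s_pos])
      (simp add: continuous_on_eq_continuous_at)
  with wp penalised_uniform_limit[OF _ s_lim]
  show "\<exists>fn :: nat \<Rightarrow> 'a \<Rightarrow> 'b.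
           (\<forall>S. bounded S \<longrightarrow> uniform_limit S fn f sequentially) \<and>
           (\<forall>n. x \<in> Eff C (fn n)) \<and>
           (\<forall>n. DH_well_posed_at C (fn n) x) \<and>
           (continuous_on UNIV f \<longrightarrow> (\<forall>n. x \<in> StEff C (fn n)))"
    by (intro exI[of _ "\<lambda>n. penalised f x e (s n)"]) (auto simp: DH_well_posed_at_def)
qed

end
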